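(* Let $p(x),q(x)$ be polynomials with real coefficients and fix a real number $x$ with $p(x)\neq 0$, $q(x)\neq 0$ and $p(x)^2+4q(x)>0$; write $p=p(x)$, $q=q(x)$, and $$\alpha=\frac{p+\sqrt{p^2+4q}}{2},\qquad \beta=\frac{p-\sqrt{p^2+4q}}{2}.$$ Let $a,r$ be nonzero real numbers, let $n\ge 1$, and set $f_k=\dfrac{F_{p,q,k}(x)}{ar^k}$ for $k\ge 0$. Let $\mathcal{F}_n$ be the $n\times n$ right circulant matrix with first row $(f_0,f_1,\dots,f_{n-1})$, i.e. the matrix whose $(i,j)$ entry ($0\le i,j\le n-1$) is $f_{(j-i)\bmod n}$. Let $w=e^{2\pi i/n}$. Then the eigenvalues of $\mathcal{F}_n$ (with multiplicity) are $$\lambda_m=\frac{-rF_{p,q,n}(x)-w^{-m}\left(qF_{p,q,n-1}(x)-r^{n}\right)}{ar^{n-1}\left(r-\alpha w^{-m}\right)\left(r-\beta w^{-m}\right)},\qquad m=0,1,\dots,n-1,$$ where it is assumed that $(r-\alpha w^{-m})(r-\beta w^{-m})\neq 0$ for all $m$ so that these expressions are defined.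
   Context: The generalized Fibonacci polynomials are defined by $F_{p,q,0}(x)=0$, $F_{p,q,1}(x)=1$ and $F_{p,q,n+1}(x)=p(x)F_{p,q,n}(x)+q(x)F_{p,q,n-1}(x)$ for $n\ge 1$. *)

theory Defs
  imports Complex_Main "Jordan_Normal_Form.Spectral_Radius"
begin

fun gen_fib_poly :: "'a :: comm_ring_1 poly \<Rightarrow> 'a poly \<Rightarrow> nat \<Rightarrow> 'a poly" where
  "gen_fib_poly p q 0 = 0"
| "gen_fib_poly p q (Suc 0) = 1"
| "gen_fib_poly p q (Suc (Suc n)) = p * gen_fib_poly p q (Suc n) + q * gen_fib_poly p q n"

text \<open>The index \<open>j - i\<close> is taken in the integers, so that \<open>mod\<close> yields the residue
  in \<open>{0..<n}\<close> also below the diagonal.\<close>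

definition right_circulant_mat :: "nat \<Rightarrow> (nat \<Rightarrow> 'a) \<Rightarrow> 'a mat" where
  "right_circulant_mat n c = mat n n (\<lambda>(i, j). c (nat ((int j - int i) mod int n)))"

text \<open>Eigenvalues counted with algebraic multiplicity. Only roots in the entry type itself are
  seen, so a real matrix has to be mapped into the complex numbers first.\<close>

definition eigenvalue_mset :: "'a :: idom mat \<Rightarrow> 'a multiset" where
  "eigenvalue_mset A = proots (char_poly A)"

end

theory Submission
  imports Defs
begin

text \<open>
  If \<open>z ^ n = 1\<close>, then \<open>(1, z, \<dots>, z\<^bsup>n-1\<^esup>)\<close> is an eigenvector of the right circulant matrix
  with first row \<open>c\<close>, with eigenvalue \<open>\<Sum>k<n. c k * z ^ k\<close>. The \<open>n\<close> roots of unity therefore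
  diagonalise the matrix by a Fourier matrix. For the Fibonacci row the eigenvalue is a
  truncation of the generating series of \<open>F\<close> at \<open>t = z / r\<close>; multiplying it by
  \<open>1 - P t - Q t\<^sup>2 = (1 - \<alpha> t) (1 - \<beta> t)\<close> makes it telescope.
\<close>

lemma right_circulant_mat_carrier [simp]: "right_circulant_mat n c \<in> carrier_mat n n"
  by (simp add: right_circulant_mat_def)

lemma map_mat_right_circulant_mat:
  "map_mat h (right_circulant_mat n c) = right_circulant_mat n (\<lambda>k. h (c k))"
  by (auto simp: right_circulant_mat_def)

text \<open>Row \<open>i\<close> of the eigenvector equation. Since \<open>z ^ n = 1\<close>, powers
  of \<open>z\<close> depend only on exponents mod \<open>n\<close>, so the shift \<open>k\<close>
  to \<open>(i + k) mod n\<close>, a bijection of the indices, pulls out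
  \<open>z ^ i\<close>.\<close>

lemma sum_circulant_row:
  fixes z :: "'a :: comm_semiring_1"
  assumes z: "z ^ n = 1" and i: "i < n"
  shows "(\<Sum>j<n. c (nat ((int j - int i) mod int n)) * z ^ j) = (\<Sum>k<n. c k * z ^ k) * z ^ i"
proof -
  have pow: "z ^ (m mod n) = z ^ m" for m
  proof -
    have "z ^ m = z ^ (n * (m div n) + m mod n)" by simp
    also have "\<dots> = z ^ (m mod n)" unfolding power_add power_mult z by simp
    finally show ?thesis ..
  qed
  have inv1: "(i + nat ((int j - int i) mod int n)) mod n = j" if "j < n" for j
  proof -
    have "int ((i + nat ((int j - int i) mod int n)) mod n) = (int i + (int j - int i) mod int n) mod int n"
      using i by (simp add: zmod_int)
    also have "\<dots> = int j" using that by (simp add: mod_simps)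
    finally show ?thesis by simp
  qed
  have inv2: "nat ((int ((i + k) mod n) - int i) mod int n) = k" if "k < n" for k
    using that by (simp add: zmod_int mod_simps)
  have "(\<Sum>k<n. c k * z ^ k) * z ^ i = (\<Sum>k<n. c k * z ^ ((i + k) mod n))"
    by (simp add: sum_distrib_left sum_distrib_right pow power_add ac_simps)
  also have "\<dots> = (\<Sum>j<n. c (nat ((int j - int i) mod int n)) * z ^ j)"
    by (rule sum.reindex_bij_witness[where j = "\<lambda>k. (i + k) mod n"
          and i = "\<lambda>j. nat ((int j - int i) mod int n)"])
       (use i inv1 inv2 in \<open>auto simp: nat_less_iff\<close>)
  finally show ?thesis ..
qed

text \<open>The columns of the Fourier matrix \<open>V\<close> are the eigenvectors. Orthogonality
  of the roots of unity gives its inverse \<open>W\<close>; characteristic 0 permits the factor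
  \<open>1/n\<close>.\<close>

lemma similar_right_circulant_mat_diag:
  fixes c z :: "nat \<Rightarrow> 'a :: field_char_0"
  assumes inj: "inj_on z {..<n}" and root: "\<And>m. m < n \<Longrightarrow> z m ^ n = 1"
  shows "similar_mat (right_circulant_mat n c) (mat_diag n (\<lambda>m. \<Sum>k<n. c k * z m ^ k))"
proof -
  define A where "A = right_circulant_mat n c"
  define D where "D = mat_diag n (\<lambda>m. \<Sum>k<n. c k * z m ^ k)"
  define V where "V = mat n n (\<lambda>(j, m). z m ^ j)"
  define W where "W = mat n n (\<lambda>(m, j). inverse (z m) ^ j / of_nat n)"
  have carr: "A \<in> carrier_mat n n" "D \<in> carrier_mat n n" "V \<in> carrier_mat n n" "W \<in> carrier_mat n n"
    by (auto simp: A_def D_def V_def W_def)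
  have nz: "z m \<noteq> 0" if "m < n" for m
    using root[OF that] that by (auto simp: power_0_left)
  have WV: "W * V = 1\<^sub>m n"
  proof (rule eq_matI)
    fix m m' assume "m < dim_row (1\<^sub>m n :: 'a mat)" "m' < dim_col (1\<^sub>m n :: 'a mat)"
    then have mm: "m < n" "m' < n" by auto
    have "(W * V) $$ (m, m') = (\<Sum>j<n. (z m' / z m) ^ j) / of_nat n"
      using mm by (simp add: W_def V_def scalar_prod_def lessThan_atLeast0 sum_divide_distrib sum_distrib_left
          divide_inverse power_mult_distrib ac_simps)
    also have "\<dots> = (if m = m' then 1 else 0)"
    proof (cases "m = m'")
      case True
      then show ?thesis using mm nz by simp
    next
      case False
      \<comment> \<open>The quotient is an n-th root of unity other than 1, so its geometric sum has
        numerator 0.\<close>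
      have "z m' / z m \<noteq> 1"
        using inj mm nz False by (auto simp: inj_on_def)
      moreover have "(z m' / z m) ^ n = 1"
        using mm root by (simp add: power_divide)
      ultimately show ?thesis using False by (simp add: geometric_sum)
    qed
    finally show "(W * V) $$ (m, m') = 1\<^sub>m n $$ (m, m')" using mm by simp
  qed (use carr in auto)
  \<comment> \<open>A one-sided inverse of a square matrix is two-sided; this avoids summing over
    the roots themselves.\<close>
  have VW: "V * W = 1\<^sub>m n"
    by (rule mat_mult_left_right_inverse[OF carr(4,3) WV])
  have "A * V = V * D"
  proof (rule eq_matI)
    fix i m assume "i < dim_row (V * D)" "m < dim_col (V * D)"
    then have im: "i < n" "m < n" using carr by auto
    have "(A * V) $$ (i, m) = (\<Sum>j<n. c (nat ((int j - int i) mod int n)) * z m ^ j)"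
      using im by (simp add: A_def right_circulant_mat_def V_def scalar_prod_def lessThan_atLeast0)
    also have "\<dots> = (V * D) $$ (i, m)"
      using im root carr(3) unfolding D_def
      by (subst mat_diag_mult_right) (auto simp: sum_circulant_row V_def)
    finally show "(A * V) $$ (i, m) = (V * D) $$ (i, m)" .
  qed (use carr in auto)
  then have "V * D * W = A * (V * W)"
    using carr by (metis assoc_mult_mat)
  then have "A = V * D * W" using carr VW by simp
  then show ?thesis
    using carr VW WV unfolding A_def[symmetric] D_def[symmetric] by (intro similar_matI[where P = V and Q = W]) auto
qed

lemma char_poly_mat_diag: "char_poly (mat_diag n d) = (\<Prod>m<n. [:- d m, 1:])"
proof -
  have "char_poly (mat_diag n d) = (\<Prod>a \<leftarrow> diag_mat (mat_diag n d). [:- a, 1:])"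
    by (rule char_poly_upper_triangular[of _ n]) (auto simp: upper_triangular_def mat_diag_def)
  also have "diag_mat (mat_diag n d) = map d [0..<n]"
    by (simp add: diag_mat_def mat_diag_def)
  finally show ?thesis
    by (simp add: prod.list_conv_set_nth lessThan_atLeast0)
qed

text \<open>Similar matrices share their characteristic polynomial, here a product of linear factors
  indexed by \<open>m\<close>. Indexing by \<open>m\<close> keeps coinciding eigenvalues apart,
  which gives the multiplicities.\<close>

lemma proots_char_poly_right_circulant_mat:
  fixes c z :: "nat \<Rightarrow> 'a :: field_char_0"
  assumes "inj_on z {..<n}" and "\<And>m. m < n \<Longrightarrow> z m ^ n = 1"
  shows "proots (char_poly (right_circulant_mat n c))
    = image_mset (\<lambda>m. \<Sum>k<n. c k * z m ^ k) (mset_set {..<n})"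
proof -
  have "proots (\<Prod>m\<in>I. [:- d m, 1:]) = image_mset d (mset_set I)"
    if "finite I" for d :: "nat \<Rightarrow> 'a" and I
    using that by (subst proots_prod) (auto simp: sum_unfold_sum_mset)
  then show ?thesis
    by (simp add: char_poly_similar[OF similar_right_circulant_mat_diag[OF assms]] char_poly_mat_diag)
qed

text \<open>The characteristic polynomial is monic, hence nonzero, so \<open>proots\<close> collects
  exactly its roots.\<close>

lemma spectrum_eq_proots_char_poly:
  fixes A :: "'a :: field mat"
  assumes "A \<in> carrier_mat n n"
  shows "spectrum A = set_mset (proots (char_poly A))"
proof -
  have "char_poly A \<noteq> 0"
    using degree_monic_char_poly[OF assms] by auto
  then show ?thesis
    by (simp add: spectrum_root_char_poly[OF assms])
qed

text \<open>In the product the recurrence cancels the coefficients of \<open>t ^ k\<close> for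
  \<open>2 \<le> k \<le> n\<close>. The initial values leave \<open>t\<close>, and the truncation
  leaves the two top terms.\<close>

lemma sum_second_order_recurrence:
  fixes F :: "nat \<Rightarrow> 'a :: comm_ring_1"
  assumes "F 0 = 0" "F 1 = 1" and rec: "\<And>n. F (Suc (Suc n)) = P * F (Suc n) + Q * F n"
  shows "(1 - P * t - Q * t ^ 2) * (\<Sum>k<Suc n. F k * t ^ k)
    = t - F (Suc n) * t ^ Suc n - Q * F n * t ^ (n + 2)"
proof (induction n)
  case 0
  then show ?case using assms by simp
next
  case (Suc n)
  show ?case
    unfolding sum.lessThan_Suc[of _ "Suc n"] distrib_left Suc.IH rec
    by (simp add: algebra_simps power2_eq_square)
qed

theorem theorem1:
  fixes p q :: "real poly" and x a r \<alpha> \<beta> P Q :: real and n :: nat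
    and F f :: "nat \<Rightarrow> real" and w :: complex and ev :: "nat \<Rightarrow> complex"
    and \<F> :: "complex mat"
  defines "P \<equiv> poly p x"
    and "Q \<equiv> poly q x"
    and "\<alpha> \<equiv> (P + sqrt (P^2 + 4 * Q)) / 2"
    and "\<beta> \<equiv> (P - sqrt (P^2 + 4 * Q)) / 2"
    and "F \<equiv> \<lambda>k. poly (gen_fib_poly p q k) x"
    and "f \<equiv> \<lambda>k. F k / (a * r ^ k)"
    and "\<F> \<equiv> map_mat complex_of_real (right_circulant_mat n f)"
    and "w \<equiv> exp (2 * complex_of_real pi * \<i> / of_nat n)"
    and "ev \<equiv> \<lambda>m.
      (- of_real r * of_real (F n)
         - w powi (- int m) * (of_real Q * of_real (F (n - 1)) - of_real r ^ n)) /
      (of_real a * of_real r ^ (n - 1)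
         * (of_real r - of_real \<alpha> * w powi (- int m))
         * (of_real r - of_real \<beta> * w powi (- int m)))"
  assumes "P \<noteq> 0" and "Q \<noteq> 0" and "P^2 + 4 * Q > 0"
    and "a \<noteq> 0" and "r \<noteq> 0" and "n \<ge> 1"
    and "\<And>m. m < n \<Longrightarrow>
      (of_real r - of_real \<alpha> * w powi (- int m)) * (of_real r - of_real \<beta> * w powi (- int m)) \<noteq> 0"
  shows "spectrum \<F> = ev ` {0..<n} \<and>
    eigenvalue_mset \<F> = image_mset ev (mset_set {0..<n})"
proof -
  \<comment> \<open>The inverses of the usual enumeration of the n-th roots of unity, ordered so
    that index \<open>m\<close> matches \<open>ev m\<close>.\<close>
  define z where "z m = w powi (- int m)" for m
  have n: "n > 0" using \<open>n \<ge> 1\<close> by simp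
  have z_cis: "z m = inverse (cis (2 * pi * real m / real n))" for m
    by (simp add: z_def w_def power_int_minus cis_conv_exp exp_of_nat_mult[symmetric] field_simps)
  have bij: "bij_betw (\<lambda>k. cis (2 * pi * real k / real n)) {..<n} {z. z ^ n = 1}"
    by (rule bij_betw_roots_unity[OF n])
  have inj: "inj_on z {..<n}"
    using bij unfolding z_cis bij_betw_def inj_on_def by (simp del: cis_inverse)
  have root: "z m ^ n = 1" if "m < n" for m
    using bij_betwE[OF bij] that unfolding z_cis by (simp add: power_inverse del: cis_inverse)
  have F: "F 0 = 0" "F 1 = 1" "\<And>k. F (Suc (Suc k)) = P * F (Suc k) + Q * F k"
    by (simp_all add: F_def P_def Q_def)
  have ev: "(\<Sum>k<n. complex_of_real (f k) * z m ^ k) = ev m" if "m < n" for m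
  proof -
    define S where "S = (\<Sum>k<n. complex_of_real (f k) * z m ^ k)"
    define t where "t = z m / of_real r"
    define A B where "A = complex_of_real \<alpha>" and "B = complex_of_real \<beta>"
    have r: "complex_of_real r \<noteq> 0" and a: "complex_of_real a \<noteq> 0"
      using \<open>r \<noteq> 0\<close> \<open>a \<noteq> 0\<close> by auto
    \<comment> \<open>Vieta for \<open>X^2 - P X - Q\<close>; the positive discriminant lets the
      square root be squared away.\<close>
    have "\<alpha> + \<beta> = P" "\<alpha> * \<beta> = - Q"
      using \<open>P^2 + 4 * Q > 0\<close>
      by (auto simp: \<alpha>_def \<beta>_def field_simps power2_eq_square[symmetric])
    then have AB: "complex_of_real P = A + B" "complex_of_real Q = - (A * B)"
      by (metis A_def B_def of_real_add, metis A_def B_def of_real_mult of_real_minus minus_minus)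
    \<comment> \<open>The row ends at index \<open>n - 1 = k\<close>, so \<open>F n\<close> and
      \<open>F (n - 1)\<close> are the boundary values of the truncated series.\<close>
    obtain k where k: "n = Suc k" using n gr0_implies_Suc by blast
    have S: "of_real a * S = (\<Sum>k<n. complex_of_real (F k) * t ^ k)"
      using a by (simp add: S_def f_def t_def sum_distrib_left power_divide)
    have "(1 - of_real P * t - of_real Q * t ^ 2) * (\<Sum>k<n. complex_of_real (F k) * t ^ k)
      = t - of_real (F n) * t ^ n - of_real Q * of_real (F (n - 1)) * t ^ (n + 1)"
      unfolding k using sum_second_order_recurrence[of "\<lambda>k. complex_of_real (F k)" "of_real P" "of_real Q" t k] F
      by simp
    then have "(1 - A * t) * (1 - B * t) * (of_real a * S)
      = t - of_real (F n) * t ^ n - of_real Q * of_real (F (n - 1)) * t ^ (n + 1)"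
      unfolding S AB by (simp add: algebra_simps power2_eq_square)
    moreover have tn: "t ^ n = 1 / of_real r ^ n"
      using root[OF that] by (simp add: t_def power_divide)
    \<comment> \<open>Of the \<open>n + 1\<close> factors \<open>r\<close>, two turn
      \<open>1 - A * t\<close> and \<open>1 - B * t\<close> into \<open>r - A * z m\<close> and
      \<open>r - B * z m\<close>; the other \<open>n - 1\<close> form the power of \<open>r\<close>
      in the denominator of \<open>ev m\<close>.\<close>
    ultimately have "(1 - A * t) * (1 - B * t) * (of_real a * S) * of_real r ^ (n + 1)
      = (t - of_real (F n) / of_real r ^ n - of_real Q * of_real (F (n - 1)) * (t / of_real r ^ n)) * of_real r ^ (n + 1)"
      by simp
    also have "\<dots> = - of_real r * of_real (F n) - z m * (of_real Q * of_real (F (n - 1)) - of_real r ^ n)"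
      using r by (simp add: t_def field_simps)
    also have "(1 - A * t) * (1 - B * t) * (of_real a * S) * of_real r ^ (n + 1)
      = S * (of_real a * of_real r ^ (n - 1) * (of_real r - A * z m) * (of_real r - B * z m))"
      using r by (simp add: t_def k field_simps)
    \<comment> \<open>\<open>assms(16)\<close> is the non-vanishing of the two linear factors, which
      allows division by the denominator.\<close>
    finally show ?thesis
      using assms(16)[OF that] a r
      unfolding ev_def S_def[symmetric] A_def B_def z_def[symmetric]
      by (subst eq_divide_eq) simp
  qed
  have "\<F> = right_circulant_mat n (\<lambda>k. complex_of_real (f k))"
    by (simp add: \<F>_def map_mat_right_circulant_mat)
  then have "\<F> \<in> carrier_mat n n"
    and "proots (char_poly \<F>) = image_mset ev (mset_set {..<n})"
    using ev by (auto simp: proots_char_poly_right_circulant_mat[OF inj root] intro!: image_mset_cong)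
  then show ?thesis
    by (simp add: spectrum_eq_proots_char_poly eigenvalue_mset_def lessThan_atLeast0)
qed

end
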